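(* Let $n$ and $d=d(n)$ be growing parameters such that $d(n)\le\sqrt{n}$. Then there is a monotone algebraic formula $F$ of size at most $n$ and depth $O(\log d)$ computing a polynomial $P\in\mathbb{F}[x_1,\dots,x_n]$ of degree at most $d$ such that any monotone formula $F'$ of depth $o(\log d)$ computing $P$ must have size $n^{\omega(1)}$.
   Context: An algebraic formula over $\mathbb{F}[x_1,\dots,x_n]$ is a rooted tree with edges directed towards the root; leaves are labelled by variables or by the constant $1$, edges are labelled by non-zero field constants, and internal nodes are labelled $+$ (computing the linear combination of its children with edge weights as coefficients) or $\times$ (computing the product of its children). Fan-in is unbounded. The size of a formula is its number of leaves; its depth is the length of a longest leaf-to-root path. A parse tree of a formula is defined inductively: at a $+$-gate take a parse tree of one child (with the connecting edge), at a $\times$-gate take a parse tree of every child (with the connecting edges), and a leaf's only parse tree is itself; a parse tree computes the monomial given by the product of its leaf labels times the product of its edge constants, and the formula computes the sum of these over all parse trees. A formula is monotone if every monomial computed by one of its parse trees has a non-zero coefficient in the polynomial computed by the formula. *)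

theory Defs
  imports Complex_Main "HOL-Library.Poly_Mapping" "HOL-Library.Landau_Symbols"
begin

text \<open>
  A polynomial in variables indexed by natural numbers is a finitely supported function from
  exponent vectors to coefficients; \<^theory>\<open>HOL-Library.Poly_Mapping\<close> provides its ring structure.
\<close>

type_synonym monom = "nat \<Rightarrow>\<^sub>0 nat"
type_synonym 'a mpoly = "monom \<Rightarrow>\<^sub>0 'a"

definition monom_degree :: "monom \<Rightarrow> nat" where
  "monom_degree m = (\<Sum>i\<in>Poly_Mapping.keys m. Poly_Mapping.lookup m i)"

definition total_degree :: "'a::zero mpoly \<Rightarrow> nat" where
  "total_degree p = Max (insert 0 (monom_degree ` Poly_Mapping.keys p))"

text \<open>
  A gate stores its children in a list, each child together with the label of the edge from the
  child to the gate. Edges into product gates carry labels as well.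
\<close>

datatype 'a formula =
    Var nat
  | One
  | Plus "('a \<times> 'a formula) list"
  | Times "('a \<times> 'a formula) list"

fun formula_over :: "nat \<Rightarrow> 'a::field formula \<Rightarrow> bool" where
  "formula_over n (Var i) \<longleftrightarrow> 1 \<le> i \<and> i \<le> n"
| "formula_over n One \<longleftrightarrow> True"
| "formula_over n (Plus cs) \<longleftrightarrow> cs \<noteq> [] \<and> (\<forall>(c, f) \<in> set cs. c \<noteq> 0 \<and> formula_over n f)"
| "formula_over n (Times cs) \<longleftrightarrow> cs \<noteq> [] \<and> (\<forall>(c, f) \<in> set cs. c \<noteq> 0 \<and> formula_over n f)"

fun num_leaves :: "'a formula \<Rightarrow> nat" where
  "num_leaves (Var i) = 1"
| "num_leaves One = 1"
| "num_leaves (Plus cs) = (\<Sum>(c, f)\<leftarrow>cs. num_leaves f)"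
| "num_leaves (Times cs) = (\<Sum>(c, f)\<leftarrow>cs. num_leaves f)"

fun depth :: "'a formula \<Rightarrow> nat" where
  "depth (Var i) = 0"
| "depth One = 0"
| "depth (Plus cs) = Suc (Max (insert 0 (set (map (\<lambda>(c, f). depth f) cs))))"
| "depth (Times cs) = Suc (Max (insert 0 (set (map (\<lambda>(c, f). depth f) cs))))"

text \<open>
  A parse tree keeps the labels of the edges it uses. All parse trees of a formula are collected in
  a list, so that equal-looking parse trees using different children of a sum gate are counted
  separately.
\<close>

datatype 'a parse_tree =
    PVar nat
  | POne
  | PPlus 'a "'a parse_tree"
  | PTimes "('a \<times> 'a parse_tree) list"

fun parse_trees :: "'a formula \<Rightarrow> 'a parse_tree list" where
  "parse_trees (Var i) = [PVar i]"
| "parse_trees One = [POne]"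
| "parse_trees (Plus cs) = concat (map (\<lambda>(c, f). map (PPlus c) (parse_trees f)) cs)"
| "parse_trees (Times cs) =
     map PTimes (product_lists (map (\<lambda>(c, f). map (Pair c) (parse_trees f)) cs))"

fun pt_monom :: "'a parse_tree \<Rightarrow> monom" where
  "pt_monom (PVar i) = Poly_Mapping.single i 1"
| "pt_monom POne = 0"
| "pt_monom (PPlus c t) = pt_monom t"
| "pt_monom (PTimes ts) = (\<Sum>(c, t)\<leftarrow>ts. pt_monom t)"

fun pt_coeff :: "'a::comm_semiring_1 parse_tree \<Rightarrow> 'a" where
  "pt_coeff (PVar i) = 1"
| "pt_coeff POne = 1"
| "pt_coeff (PPlus c t) = c * pt_coeff t"
| "pt_coeff (PTimes ts) = (\<Prod>(c, t)\<leftarrow>ts. c * pt_coeff t)"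

definition pt_poly :: "'a::comm_semiring_1 parse_tree \<Rightarrow> 'a mpoly" where
  "pt_poly t = Poly_Mapping.single (pt_monom t) (pt_coeff t)"

definition formula_poly :: "'a::comm_semiring_1 formula \<Rightarrow> 'a mpoly" where
  "formula_poly f = (\<Sum>t\<leftarrow>parse_trees f. pt_poly t)"

definition monotone_formula :: "'a::comm_semiring_1 formula \<Rightarrow> bool" where
  "monotone_formula f \<longleftrightarrow>
     (\<forall>t \<in> set (parse_trees f). Poly_Mapping.lookup (formula_poly f) (pt_monom t) \<noteq> 0)"

text \<open>The parse-tree semantics agrees with the gate-by-gate evaluation of a formula.\<close>

lemma formula_poly_leaf:
  "formula_poly (Var i) = Poly_Mapping.single (Poly_Mapping.single i 1) 1"
  "formula_poly One = 1"
  by (simp_all add: formula_poly_def pt_poly_def)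

lemma pt_poly_PPlus: "pt_poly (PPlus c t) = Poly_Mapping.single 0 c * pt_poly t"
  by (simp add: pt_poly_def mult_single)

lemma pt_poly_PTimes:
  "pt_poly (PTimes ts) = (\<Prod>(c, t)\<leftarrow>ts. Poly_Mapping.single 0 c * pt_poly t)"
proof (induction ts)
  case (Cons a ts)
  obtain c t where a: "a = (c, t)" by force
  have "pt_poly (PTimes (a # ts)) = (Poly_Mapping.single 0 c * pt_poly t) * pt_poly (PTimes ts)"
    by (simp add: a pt_poly_def mult_single)
  with Cons.IH show ?case by (simp add: a)
qed (simp add: pt_poly_def)

lemma formula_poly_Plus:
  "formula_poly (Plus cs) = (\<Sum>(c, f)\<leftarrow>cs. Poly_Mapping.single 0 c * formula_poly f)"
  by (induction cs)
    (auto simp: formula_poly_def pt_poly_PPlus sum_list_const_mult comp_def)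

lemma sum_list_product_lists:
  fixes g :: "'b \<Rightarrow> 'c::comm_semiring_1"
  shows "(\<Sum>xs\<leftarrow>product_lists xss. \<Prod>x\<leftarrow>xs. g x) = (\<Prod>xs\<leftarrow>xss. \<Sum>x\<leftarrow>xs. g x)"
proof (induction xss)
  case (Cons ys yss)
  have "(\<Sum>xs\<leftarrow>concat (map (\<lambda>x. map (Cons x) (product_lists yss)) zs). \<Prod>x\<leftarrow>xs. g x) =
      (\<Sum>x\<leftarrow>zs. g x) * (\<Sum>xs\<leftarrow>product_lists yss. \<Prod>x\<leftarrow>xs. g x)" for zs
    by (induction zs) (simp_all add: comp_def sum_list_const_mult distrib_right)
  with Cons.IH show ?case by simp
qed simp

lemma formula_poly_Times:
  "formula_poly (Times cs) = (\<Prod>(c, f)\<leftarrow>cs. Poly_Mapping.single 0 c * formula_poly f)"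
proof -
  have "formula_poly (Times cs) =
      (\<Prod>xs\<leftarrow>map (\<lambda>(c, f). map (Pair c) (parse_trees f)) cs.
         \<Sum>(c, t)\<leftarrow>xs. Poly_Mapping.single 0 c * pt_poly t)"
    by (simp add: formula_poly_def comp_def pt_poly_PTimes sum_list_product_lists)
  also have "\<dots> = (\<Prod>(c, f)\<leftarrow>cs. Poly_Mapping.single 0 c * formula_poly f)"
    by (simp add: comp_def formula_poly_def sum_list_const_mult case_prod_unfold)
  finally show ?thesis .
qed

end

theory Submission
  imports Defs "HOL-Library.Set_Algebras"
begin

text \<open>
  In a monotone formula nothing cancels, so it computes its set of monomials through unions and
  Minkowski sums. The hard polynomial is the complete read-once formula of alternating sums of fan-in
  \<open>r\<close> and products of fan-in \<open>2\<close>, of degree \<open>2 ^ k\<close>, with about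
  \<open>n = (2 r) ^ k\<close> variables and \<open>r ^ (2 ^ k - 1)\<close> monomials: one summand is
  chosen at each of the \<open>2 ^ k - 1\<close> inner nodes of a binary tree. A product of \<open>q\<close>
  nonconstant sets inside this monomial set has at most \<open>r ^ (2 ^ k - q)\<close> elements. A
  formula of size \<open>s\<close> and depth \<open>\<Delta>\<close> is covered by \<open>s\<close> such
  products, one per leaf, and as the degree has to fall from \<open>2 ^ k\<close> to \<open>1\<close> along
  at most \<open>\<Delta>\<close> gates, \<open>q - 1\<close> is at least
  \<open>C k - K \<Delta>\<close>, for every \<open>C\<close> and some \<open>K\<close> depending on
  \<open>C\<close>. Hence \<open>s \<ge> r ^ (C k - K \<Delta>)\<close>, which for
  \<open>\<Delta> = o(k)\<close> exceeds every power of \<open>n \<le> r ^ (3 k)\<close>.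
\<close>

section \<open>Monomials and Minkowski sums\<close>

text \<open>Exponents are natural numbers, so adding monomials cancels nothing.\<close>

lemma keys_add_nat: "Poly_Mapping.keys (a + b) = Poly_Mapping.keys a \<union> Poly_Mapping.keys (b :: monom)"
  by (auto simp: in_keys_iff lookup_add)

lemma monom_degree_superset:
  assumes "finite A" "Poly_Mapping.keys m \<subseteq> A"
  shows "monom_degree m = (\<Sum>i\<in>A. Poly_Mapping.lookup m i)"
  unfolding monom_degree_def
  by (rule sum.mono_neutral_left) (use assms in \<open>auto simp: in_keys_iff\<close>)

lemma monom_degree_add: "monom_degree (a + b) = monom_degree a + monom_degree b"
proof -
  let ?A = "Poly_Mapping.keys a \<union> Poly_Mapping.keys b"
  have "monom_degree (a + b) = (\<Sum>i\<in>?A. Poly_Mapping.lookup (a + b) i)"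
    by (rule monom_degree_superset) (auto simp: keys_add_nat)
  also have "\<dots> = monom_degree a + monom_degree b"
    by (simp add: lookup_add sum.distrib monom_degree_superset[where A = ?A])
  finally show ?thesis .
qed

lemma monom_degree_0 [simp]: "monom_degree 0 = 0"
  by (simp add: monom_degree_def)

lemma monom_degree_eq_0_iff: "monom_degree m = 0 \<longleftrightarrow> m = 0"
proof
  assume "monom_degree m = 0"
  then show "m = 0"
    by (intro poly_mapping_eqI) (auto simp: monom_degree_def in_keys_iff)
qed simp

text \<open>Sets the variables outside \<open>V\<close> to 1. Being additive, this commutes with
  Minkowski sums and serves to separate the contributions of two subtrees.\<close>

definition monom_restrict :: "nat set \<Rightarrow> monom \<Rightarrow> monom" where
  "monom_restrict V m = (\<Sum>i\<in>Poly_Mapping.keys m \<inter> V. Poly_Mapping.single i (Poly_Mapping.lookup m i))"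

lemma lookup_monom_restrict:
  "Poly_Mapping.lookup (monom_restrict V m) j = (if j \<in> V then Poly_Mapping.lookup m j else 0)"
proof -
  have "Poly_Mapping.lookup (monom_restrict V m) j =
      (\<Sum>i\<in>Poly_Mapping.keys m \<inter> V. if i = j then Poly_Mapping.lookup m j else 0)"
    unfolding monom_restrict_def lookup_sum
    by (rule sum.cong) (auto simp: lookup_single when_def)
  then show ?thesis
    by (auto simp: in_keys_iff)
qed

lemma monom_restrict_0 [simp]: "monom_restrict V 0 = 0"
  by (simp add: monom_restrict_def)

lemma monom_restrict_add: "monom_restrict V (a + b) = monom_restrict V a + monom_restrict V b"
  by (rule poly_mapping_eqI) (simp add: lookup_monom_restrict lookup_add)

lemma monom_restrict_id: "Poly_Mapping.keys m \<subseteq> V \<Longrightarrow> monom_restrict V m = m"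
  by (rule poly_mapping_eqI) (auto simp: lookup_monom_restrict in_keys_iff)

lemma monom_restrict_eq_0: "Poly_Mapping.keys m \<inter> V = {} \<Longrightarrow> monom_restrict V m = 0"
  by (simp add: monom_restrict_def)

lemma monom_restrict_Compl_add: "monom_restrict V m + monom_restrict (- V) m = m"
  by (rule poly_mapping_eqI) (simp add: lookup_monom_restrict lookup_add)

lemma sum_list_sets_nonempty: "(\<And>B. B \<in> set Bs \<Longrightarrow> B \<noteq> {}) \<Longrightarrow> sum_list Bs \<noteq> {}"
  by (induction Bs) (auto simp: set_plus_def)

lemma image_monom_restrict_sum_list:
  "monom_restrict V ` sum_list Bs = sum_list (map ((`) (monom_restrict V)) Bs)"
proof (induction Bs)
  case (Cons B Bs)
  have "monom_restrict V ` (B + C) = monom_restrict V ` B + monom_restrict V ` C" for C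
    by (force simp: set_plus_def monom_restrict_add)
  with Cons.IH show ?case
    by simp
qed simp

lemma sum_list_filter_zero_set:
  fixes Bs :: "'a::comm_monoid_add set list"
  shows "sum_list (filter (\<lambda>B. B \<noteq> {0}) Bs) = sum_list Bs"
  by (induction Bs) auto

section \<open>Homogeneous sets of monomials\<close>

definition homogeneous :: "nat \<Rightarrow> monom set \<Rightarrow> bool" where
  "homogeneous D X \<longleftrightarrow> (\<forall>m\<in>X. monom_degree m = D)"

text \<open>Fixing an element of one summand leaves only one possible degree in the other.\<close>

lemma homogeneous_plusE:
  assumes "homogeneous D (A + B)" "A \<noteq> {}" "B \<noteq> {}"
  obtains i j where "homogeneous i A" "homogeneous j B" "D = i + j"
proof -
  obtain a b where ab: "a \<in> A" "b \<in> B"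
    using assms by auto
  have *: "monom_degree x + monom_degree y = D" if "x \<in> A" "y \<in> B" for x y
    using assms that by (force simp: homogeneous_def set_plus_def monom_degree_add)
  have "homogeneous (monom_degree a) A" "homogeneous (monom_degree b) B"
    unfolding homogeneous_def using * ab by (metis add_right_cancel add_left_cancel)+
  with *[OF ab] that show ?thesis
    by metis
qed

lemma homogeneous_sum_listE:
  assumes "homogeneous D (sum_list Bs)" "\<And>B. B \<in> set Bs \<Longrightarrow> B \<noteq> {}"
  obtains e where "\<And>B. B \<in> set Bs \<Longrightarrow> homogeneous (e B) B" "D = sum_list (map e Bs)"
proof -
  \<comment> \<open>Reading the degree off a chosen element makes \<open>e\<close> depend on the set
    alone, so it agrees on repeated list entries.\<close>
  define e where "e B = monom_degree (SOME b. b \<in> B)" for B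
  have e: "i = e B" if "homogeneous i B" "B \<noteq> {}" for i B
    using that by (auto simp: e_def homogeneous_def some_in_eq)
  have "(\<forall>B\<in>set Bs. homogeneous (e B) B) \<and> D = sum_list (map e Bs)"
    using assms
  proof (induction Bs arbitrary: D)
    case Nil
    then show ?case by (simp add: homogeneous_def)
  next
    case (Cons B Bs)
    obtain i j where "homogeneous i B" "homogeneous j (sum_list Bs)" "D = i + j"
      using homogeneous_plusE[of D B "sum_list Bs"] Cons.prems sum_list_sets_nonempty[of Bs]
      by auto
    with Cons.IH[of j] Cons.prems e[of i B] show ?case by auto
  qed
  with that show ?thesis by blast
qed

section \<open>Monomial sets of formulas\<close>

definition monoms :: "'a formula \<Rightarrow> monom set" where
  "monoms f = pt_monom ` set (parse_trees f)"

lemma monoms_Var [simp]: "monoms (Var i) = {Poly_Mapping.single i 1}"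
  and monoms_One [simp]: "monoms One = {0}"
  by (simp_all add: monoms_def)

lemma monoms_Plus: "monoms (Plus cs) = (\<Union>(c, f)\<in>set cs. monoms f)"
  by (simp add: monoms_def image_UN image_image case_prod_unfold)

lemma monoms_Times: "monoms (Times cs) = sum_list (map (\<lambda>(c, f). monoms f) cs)"
proof (induction cs)
  case (Cons a cs)
  obtain c f where [simp]: "a = (c, f)" by force
  define ps where "ps = product_lists (map (\<lambda>(c, f). map (Pair c) (parse_trees f)) cs)"
  have tail: "monoms (Times cs) = (\<lambda>ts. pt_monom (PTimes ts)) ` set ps"
    by (simp add: monoms_def ps_def image_image del: pt_monom.simps)
  have "monoms (Times (a # cs)) =
      (\<Union>t\<in>set (parse_trees f). (\<lambda>ts. pt_monom t + pt_monom (PTimes ts)) ` set ps)"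
    by (simp add: monoms_def ps_def image_UN image_image)
  also have "\<dots> = monoms f + monoms (Times cs)"
    unfolding tail unfolding monoms_def set_plus_def by blast
  finally have "monoms (Times (a # cs)) = monoms f + monoms (Times cs)" .
  with Cons.IH show ?case by simp
qed (simp add: monoms_def)

lemma keys_formula_poly_subset: "Poly_Mapping.keys (formula_poly f) \<subseteq> monoms f"
proof -
  have "Poly_Mapping.keys (\<Sum>t\<leftarrow>ts. pt_poly t) \<subseteq> pt_monom ` set ts" for ts :: "'a::comm_semiring_1 parse_tree list"
  proof (induction ts)
    case (Cons t ts)
    have "Poly_Mapping.keys (pt_poly t) \<subseteq> {pt_monom t}"
      by (simp add: pt_poly_def)
    with Cons.IH show ?case
      using keys_add[of "pt_poly t" "\<Sum>t\<leftarrow>ts. pt_poly t"] by auto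
  qed simp
  then show ?thesis
    by (simp add: formula_poly_def monoms_def)
qed

text \<open>Monotonicity of the competing formula enters the lower bound only through this equality;
  afterwards only sets of monomials matter.\<close>

lemma monotone_formula_keys:
  "monotone_formula f \<Longrightarrow> Poly_Mapping.keys (formula_poly f) = monoms f"
  using keys_formula_poly_subset[of f]
  by (auto simp: monotone_formula_def monoms_def in_keys_iff)

text \<open>Each coefficient comes from a single parse tree, so nothing can cancel, whatever the
  characteristic.\<close>

lemma monotone_formula_distinct:
  assumes "distinct (map pt_monom (parse_trees f))"
    and "\<And>t. t \<in> set (parse_trees f) \<Longrightarrow> pt_coeff t \<noteq> 0"
  shows "monotone_formula f"
proof -
  have *: "Poly_Mapping.lookup (\<Sum>t\<leftarrow>ts. pt_poly t) (pt_monom s) = pt_coeff s"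
    if "distinct (map pt_monom ts)" "s \<in> set ts" for s and ts :: "'a parse_tree list"
    using that
  proof (induction ts)
    case (Cons t ts)
    have zero: "Poly_Mapping.lookup (\<Sum>t\<leftarrow>us. pt_poly t) m = 0" if "m \<notin> pt_monom ` set us"
      for us :: "'a parse_tree list" and m
      using that by (induction us) (auto simp: lookup_add pt_poly_def lookup_single when_def)
    show ?case
    proof (cases "s = t")
      case True
      with Cons.prems zero[of "pt_monom t" ts] show ?thesis
        by (simp add: lookup_add pt_poly_def)
    next
      case False
      with Cons.prems have "s \<in> set ts" "pt_monom t \<noteq> pt_monom s"
        by auto
      with Cons show ?thesis
        by (simp add: lookup_add pt_poly_def lookup_single)
    qed
  qed simp
  show ?thesis
    unfolding monotone_formula_def formula_poly_def using *[OF assms(1)] assms(2) by auto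
qed

section \<open>The hard formula\<close>

text \<open>
  The variables of the formula are numbered from \<open>off\<close> to \<open>off + (2 * r) ^ k - 1\<close>,
  each labelling exactly one leaf.
\<close>

fun tree :: "nat \<Rightarrow> nat \<Rightarrow> nat \<Rightarrow> 'a::zero_neq_one formula" where
  "tree r 0 off = Var off"
| "tree r (Suc k) off = Plus (map (\<lambda>i. (1, Times
      [(1, tree r k (off + 2 * i * (2 * r) ^ k)), (1, tree r k (off + (2 * i + 1) * (2 * r) ^ k))]))
      [0..<r])"

text \<open>The recursion mentions no coefficients, which makes the counting independent of the
  field.\<close>

fun tree_monoms :: "nat \<Rightarrow> nat \<Rightarrow> nat \<Rightarrow> monom set" where
  "tree_monoms r 0 off = {Poly_Mapping.single off 1}"
| "tree_monoms r (Suc k) off =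
    (\<Union>i<r. tree_monoms r k (off + 2 * i * (2 * r) ^ k) +
           tree_monoms r k (off + (2 * i + 1) * (2 * r) ^ k))"

lemma monoms_tree: "monoms (tree r k off) = tree_monoms r k off"
  by (induction k arbitrary: off) (simp_all add: monoms_Plus monoms_Times lessThan_atLeast0)

lemma block_subset:
  fixes N :: nat
  assumes "j < 2 * r"
  shows "{off + j * N..<off + j * N + N} \<subseteq> {off..<off + 2 * r * N}"
proof -
  have "(j + 1) * N \<le> 2 * r * N"
    using assms by (intro mult_right_mono) auto
  then show ?thesis by (auto simp: algebra_simps)
qed

lemma block_disjoint:
  fixes N :: nat
  assumes "i \<noteq> j"
  shows "{off + i * N..<off + i * N + N} \<inter> {off + j * N..<off + j * N + N} = {}"
proof -
  have "(i + 1) * N \<le> j * N \<or> (j + 1) * N \<le> i * N"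
    using assms by (metis Suc_eq_plus1 linorder_neqE_nat mult_le_mono1 Suc_leI)
  then show ?thesis by (auto simp: algebra_simps)
qed

section \<open>Variables and degrees of the hard monomials\<close>

lemma keys_tree_monoms:
  "m \<in> tree_monoms r k off \<Longrightarrow> Poly_Mapping.keys m \<subseteq> {off..<off + (2 * r) ^ k}"
proof (induction k arbitrary: m off)
  case (Suc k)
  let ?N = "(2 * r) ^ k"
  obtain i a b where i: "i < r" and a: "a \<in> tree_monoms r k (off + 2 * i * ?N)"
    and b: "b \<in> tree_monoms r k (off + (2 * i + 1) * ?N)" and m: "m = a + b"
    using Suc.prems unfolding tree_monoms.simps set_plus_def by blast
  show ?case
    using Suc.IH[OF a] Suc.IH[OF b] block_subset[of "2 * i" r off ?N]
      block_subset[of "2 * i + 1" r off ?N] i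
    unfolding m keys_add_nat by auto
qed auto

lemma homogeneous_tree_monoms: "homogeneous (2 ^ k) (tree_monoms r k off)"
proof (induction k arbitrary: off)
  case 0
  then show ?case by (simp add: homogeneous_def monom_degree_def)
next
  case (Suc k)
  then have "monom_degree a = 2 ^ k" if "a \<in> tree_monoms r k off" for a off
    using that by (simp add: homogeneous_def)
  then show ?case
    by (auto simp: homogeneous_def set_plus_def monom_degree_add)
qed

text \<open>The two subtrees own disjoint blocks of variables, so a product of their monomials
  splits back into its factors.\<close>

lemma monom_restrict_branch:
  fixes r k off i :: nat
  defines "N \<equiv> (2 * r) ^ k"
  defines "V \<equiv> {off + 2 * i * N..<off + 2 * i * N + N}"
  assumes "a \<in> tree_monoms r k (off + 2 * i * N)" "b \<in> tree_monoms r k (off + (2 * i + 1) * N)"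
  shows "monom_restrict V (a + b) = a \<and> monom_restrict (- V) (a + b) = b"
proof -
  have "Poly_Mapping.keys a \<subseteq> V" "Poly_Mapping.keys b \<subseteq> {off + (2 * i + 1) * N..<off + (2 * i + 1) * N + N}"
    using assms(3,4)[THEN keys_tree_monoms] by (simp_all only: V_def N_def)
  then have "Poly_Mapping.keys a \<subseteq> V" "Poly_Mapping.keys b \<subseteq> - V"
    using block_disjoint[of "2 * i" "2 * i + 1" off N] unfolding V_def by auto
  moreover from this have "Poly_Mapping.keys a \<inter> - V = {}" "Poly_Mapping.keys b \<inter> V = {}"
    by auto
  ultimately show ?thesis
    by (simp add: monom_restrict_add monom_restrict_id monom_restrict_eq_0)
qed

lemma tree_monoms_keys_nonempty:
  assumes "m \<in> tree_monoms r k off"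
  shows "Poly_Mapping.keys m \<noteq> {}"
proof -
  have "monom_degree m = 2 ^ k"
    using homogeneous_tree_monoms assms by (auto simp: homogeneous_def)
  then show ?thesis
    by (auto simp: monom_degree_def)
qed

text \<open>Each summand owns a block of \<open>2 * (2 * r) ^ k\<close> variables. As the support is
  also nonempty, a monomial reveals the summand it comes from.\<close>

lemma keys_branch:
  assumes "m \<in> tree_monoms r k (off + 2 * i * (2 * r) ^ k) + tree_monoms r k (off + (2 * i + 1) * (2 * r) ^ k)"
  shows "Poly_Mapping.keys m \<noteq> {} \<and>
    Poly_Mapping.keys m \<subseteq> {off + i * (2 * (2 * r) ^ k)..<off + i * (2 * (2 * r) ^ k) + 2 * (2 * r) ^ k}"
proof -
  let ?N = "(2 * r) ^ k"
  obtain a b where a: "a \<in> tree_monoms r k (off + 2 * i * ?N)"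
    and b: "b \<in> tree_monoms r k (off + (2 * i + 1) * ?N)" and m: "m = a + b"
    using assms by (auto simp: set_plus_def)
  have "{off + 2 * i * ?N..<off + 2 * i * ?N + ?N} \<union> {off + (2 * i + 1) * ?N..<off + (2 * i + 1) * ?N + ?N}
      \<subseteq> {off + i * (2 * ?N)..<off + i * (2 * ?N) + 2 * ?N}"
    by (auto simp: algebra_simps)
  then show ?thesis
    using keys_tree_monoms[OF a] keys_tree_monoms[OF b] tree_monoms_keys_nonempty[OF a]
    unfolding m keys_add_nat by blast
qed

section \<open>Number of hard monomials and monotonicity of the hard formula\<close>

lemma length_parse_trees_tree:
  "r * length (parse_trees (tree r k off :: 'a::zero_neq_one formula)) = r ^ 2 ^ k"
proof (induction k arbitrary: off)
  case (Suc k)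
  define L where "L = length (parse_trees (tree r k off :: 'a formula))"
  \<comment> \<open>The extra factor \<open>r\<close> avoids the exponent \<open>2 ^ k - 1\<close>;
    cancelling it shows that the count does not depend on the offset.\<close>
  have L: "length (parse_trees (tree r k off' :: 'a formula)) = L" if "r > 0" for off'
    using Suc.IH[of off'] Suc.IH[of off] that unfolding L_def by (metis mult_cancel1 less_irrefl)
  show ?case
  proof (cases "r > 0")
    case True
    have "length (parse_trees (tree r (Suc k) off :: 'a formula)) = r * (L * L)"
      by (simp add: length_concat comp_def L[OF True] sum_list_triv)
    moreover have "r * L = r ^ 2 ^ k"
      using Suc.IH by (simp add: L_def)
    ultimately show ?thesis
      by (simp add: mult_2 power_add ac_simps)
  qed simp
qed simp

lemma set_parse_trees_coeff_tree: "t \<in> set (parse_trees (tree r k off)) \<Longrightarrow> pt_coeff t = 1"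
proof (induction k arbitrary: t off)
  case (Suc k)
  let ?N = "(2 * r) ^ k"
  obtain i a b where "a \<in> set (parse_trees (tree r k (off + 2 * i * ?N)))"
    "b \<in> set (parse_trees (tree r k (off + (2 * i + 1) * ?N)))"
    "t = PPlus 1 (PTimes [(1, a), (1, b)])"
    using Suc.prems by auto
  then show ?case
    using Suc.IH by simp
qed simp

lemma map_pt_monom_Times2:
  "map pt_monom (parse_trees (Times [(c, f), (c', g)])) =
   map (\<lambda>(a, b). a + b) (List.product (map pt_monom (parse_trees f)) (map pt_monom (parse_trees g)))"
  by (simp add: product_concat_map map_concat comp_def)

text \<open>Within a summand, restriction to the block of the first subtree recovers both factors;
  different summands have monomials with nonempty supports in disjoint blocks.\<close>

lemma distinct_pt_monoms_tree: "distinct (map pt_monom (parse_trees (tree r k off :: 'a::zero_neq_one formula)))"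
proof (induction k arbitrary: off)
  case (Suc k)
  let ?N = "(2 * r) ^ k"
  define T where "T i = Times [(1::'a, tree r k (off + 2 * i * ?N)), (1, tree r k (off + (2 * i + 1) * ?N))]" for i
  have "distinct (map pt_monom (parse_trees (T i)))" for i
  proof -
    have "inj_on (\<lambda>(a, b). a + b) (tree_monoms r k (off + 2 * i * ?N) \<times>
        tree_monoms r k (off + (2 * i + 1) * ?N))"
    proof (rule inj_onI, clarify)
      fix a b a' b'
      assume "a \<in> tree_monoms r k (off + 2 * i * ?N)"
         "a' \<in> tree_monoms r k (off + 2 * i * ?N)"
         "b \<in> tree_monoms r k (off + (2 * i + 1) * ?N)"
         "b' \<in> tree_monoms r k (off + (2 * i + 1) * ?N)"
      then have "monom_restrict ({off + 2 * i * ?N..<off + 2 * i * ?N + ?N}) (a + b) = a" "monom_restrict (- {off + 2 * i * ?N..<off + 2 * i * ?N + ?N}) (a + b) = b"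
          "monom_restrict ({off + 2 * i * ?N..<off + 2 * i * ?N + ?N}) (a' + b') = a'" "monom_restrict (- {off + 2 * i * ?N..<off + 2 * i * ?N + ?N}) (a' + b') = b'"
        using monom_restrict_branch by blast+
      moreover assume "a + b = a' + b'"
      ultimately show "a = a' \<and> b = b'" by simp
    qed
    moreover have "set (map pt_monom (parse_trees (tree r k off :: 'a formula))) = tree_monoms r k off" for off
      by (simp only: set_map monoms_def[symmetric] monoms_tree)
    ultimately show ?thesis
      unfolding T_def map_pt_monom_Times2
      by (subst distinct_map) (simp only: set_product Suc.IH distinct_product simp_thms)
  qed
  moreover have "monoms (T i) \<inter> monoms (T j) = {}" if "i \<noteq> j" for i j
  proof -
    have *: "Poly_Mapping.keys m \<noteq> {} \<and> Poly_Mapping.keys m \<subseteq> {off + i * (2 * ?N)..<off + i * (2 * ?N) + 2 * ?N}"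
      if m: "m \<in> monoms (T i)" for m i
    proof -
      have "m \<in> tree_monoms r k (off + 2 * i * ?N) + tree_monoms r k (off + (2 * i + 1) * ?N)"
        using m unfolding T_def monoms_Times by (simp add: monoms_tree)
      then show ?thesis
        by (rule keys_branch)
    qed
    show ?thesis
      using *[of _ i] *[of _ j] block_disjoint[OF that, of off "2 * ?N"] by blast
  qed
  moreover have "map pt_monom (parse_trees (tree r (Suc k) off :: 'a formula)) =
      concat (map (\<lambda>i. map pt_monom (parse_trees (T i))) [0..<r])"
    by (simp only: tree.simps parse_trees.simps T_def map_concat map_map comp_def prod.case pt_monom.simps)
  moreover have "distinct (concat (map (\<lambda>i. ms i) is))"
    if "\<And>i. distinct (ms i)" "\<And>i j. i \<noteq> j \<Longrightarrow> set (ms i) \<inter> set (ms j) = {}" "distinct is"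
    for ms :: "nat \<Rightarrow> monom list" and "is"
    using that(3)
  proof (induction "is")
    case (Cons i js)
    have "set (ms i) \<inter> set (ms j) = {}" if "j \<in> set js" for j
      using Cons.prems that by (intro \<open>\<And>i j. i \<noteq> j \<Longrightarrow> set (ms i) \<inter> set (ms j) = {}\<close>) auto
    with Cons that(1) show ?case by auto
  qed simp
  ultimately show ?case
    by (simp only:) (simp add: monoms_def)
qed simp

lemma monotone_tree: "monotone_formula (tree r k off :: 'a::field formula)"
  by (rule monotone_formula_distinct) (simp_all add: distinct_pt_monoms_tree set_parse_trees_coeff_tree)

lemma card_tree_monoms: "r * card (tree_monoms r k off) = r ^ 2 ^ k"
proof -
  \<comment> \<open>Any coefficient field would do for counting; the rationals are picked.\<close>
  let ?ms = "map pt_monom (parse_trees (tree r k off :: rat formula))"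
  have "tree_monoms r k off = set ?ms"
    by (simp only: set_map monoms_def[symmetric] monoms_tree)
  then have "card (tree_monoms r k off) = length ?ms"
    by (simp only: distinct_card[OF distinct_pt_monoms_tree])
  then show ?thesis
    by (simp add: length_parse_trees_tree)
qed

lemma finite_monoms: "finite (monoms f)"
  by (simp add: monoms_def)

section \<open>Products contained in the hard monomial set\<close>

text \<open>Containing the constant monomial forces degree 0, and then no other monomial fits. This
  turns "not the trivial factor" into "every element nonconstant".\<close>

lemma homogeneous_zero_notin:
  assumes "homogeneous d B" "B \<noteq> {0}"
  shows "0 \<notin> B"
proof
  assume "0 \<in> B"
  then have "B \<subseteq> {0}"
    using assms(1) monom_degree_eq_0_iff unfolding homogeneous_def
    by (metis monom_degree_0 singletonI subsetI)
  with \<open>0 \<in> B\<close> assms(2) show False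
    by auto
qed

lemma finite_tree_monoms: "finite (tree_monoms r k off)"
  unfolding monoms_tree[symmetric, where 'a = rat] by (rule finite_monoms)

text \<open>Each \<open>a + b\<close> lies in some summand. A nonconstant \<open>a\<close> has a
  variable in the block of that summand, so changing \<open>b\<close> cannot change the summand;
  symmetrically for \<open>b\<close>. Hence one summand serves all pairs.\<close>

lemma sumset_subset_branch:
  assumes "A + B \<subseteq> tree_monoms r (Suc k) off" "0 \<notin> A" "0 \<notin> B" "A \<noteq> {}" "B \<noteq> {}"
  obtains i where "A + B \<subseteq> tree_monoms r k (off + 2 * i * (2 * r) ^ k) +
    tree_monoms r k (off + (2 * i + 1) * (2 * r) ^ k)"
proof -
  define N where "N = (2 * r) ^ k"
  define W where "W i = tree_monoms r k (off + 2 * i * N) + tree_monoms r k (off + (2 * i + 1) * N)" for i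
  define V where "V i = {off + i * (2 * N)..<off + i * (2 * N) + 2 * N}" for i
  have "\<exists>i. a + b \<in> W i" if "a \<in> A" "b \<in> B" for a b
  proof -
    have "a + b \<in> tree_monoms r (Suc k) off"
      using assms(1) set_plus_intro[OF that] by blast
    then show ?thesis
      by (auto simp: W_def N_def)
  qed
  then obtain f where f: "a + b \<in> W (f a b)" if "a \<in> A" "b \<in> B" for a b
    by metis
  have key: "\<exists>v. v \<in> Poly_Mapping.keys m" if "m \<noteq> 0" for m :: monom
    using that by (metis keys_eq_empty equals0I)
  have V: "Poly_Mapping.keys a \<subseteq> V (f a b)" "Poly_Mapping.keys b \<subseteq> V (f a b)" if "a \<in> A" "b \<in> B" for a b
    using keys_branch[OF f[OF that, unfolded W_def N_def]]
    by (simp_all add: V_def N_def keys_add_nat)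
  have disj: "V i \<inter> V j = {}" if "i \<noteq> j" for i j
    unfolding V_def by (rule block_disjoint[OF that])
  have fb: "f a b = f a b'" if "a \<in> A" "b \<in> B" "b' \<in> B" for a b b'
  proof -
    have "a \<noteq> 0"
      using that assms by auto
    with key obtain v where "v \<in> Poly_Mapping.keys a"
      by blast
    then have "v \<in> V (f a b) \<inter> V (f a b')"
      using V(1)[OF that(1,2)] V(1)[OF that(1,3)] by auto
    with disj show ?thesis
      by blast
  qed
  have fa: "f a b = f a' b" if "a \<in> A" "a' \<in> A" "b \<in> B" for a a' b
  proof -
    have "b \<noteq> 0"
      using that assms by auto
    with key obtain v where "v \<in> Poly_Mapping.keys b"
      by blast
    then have "v \<in> V (f a b) \<inter> V (f a' b)"
      using V(2)[OF that(1,3)] V(2)[OF that(2,3)] by auto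
    with disj show ?thesis
      by blast
  qed
  obtain a0 b0 where "a0 \<in> A" "b0 \<in> B"
    using assms by auto
  have "a + b \<in> W (f a0 b0)" if "a \<in> A" "b \<in> B" for a b
    using f[OF that] fa[OF \<open>a0 \<in> A\<close> that] fb[OF \<open>a0 \<in> A\<close> \<open>b0 \<in> B\<close> that(2)] by simp
  then have "A + B \<subseteq> W (f a0 b0)"
    by (auto elim!: set_plus_elim)
  then show ?thesis
    using that by (simp add: W_def N_def)
qed

text \<open>
  A node of the tree whose leaves lie in several factors has its summand fixed by any single
  element of the product; a product of \<open>q\<close> factors fixes at least \<open>q - 1\<close> of the
  \<open>2 ^ k - 1\<close> choices.
\<close>

lemma card_sumset_tree_monoms:
  assumes "r > 0" "\<And>B. B \<in> set Bs \<Longrightarrow> B \<noteq> {}" "\<And>B. B \<in> set Bs \<Longrightarrow> 0 \<notin> B"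
    "sum_list Bs \<subseteq> tree_monoms r k off"
  shows "card (sum_list Bs) * r ^ length Bs \<le> r ^ 2 ^ k"
  using assms(2-)
proof (induction k arbitrary: off Bs)
  case 0
  show ?case
  proof (cases "length Bs \<le> 1")
    case True
    moreover have "card (sum_list Bs) \<le> 1"
      using card_mono[OF finite_tree_monoms 0(3)] by simp
    ultimately have "card (sum_list Bs) * r ^ length Bs \<le> 1 * r ^ 1"
      using assms(1) by (intro mult_mono power_increasing) auto
    then show ?thesis by simp
  next
    \<comment> \<open>Two nonconstant factors would give degree at least 2, but the only monomial
      here is a single variable.\<close>
    case False
    then obtain A B Cs where Bs: "Bs = A # B # Cs"
      by (cases Bs; cases "tl Bs") auto
    then have "A \<noteq> {}" "B \<noteq> {}" "sum_list Cs \<noteq> {}"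
      using sum_list_sets_nonempty[of Cs] 0(1) by auto
    then obtain a b c where "a \<in> A" "b \<in> B" "c \<in> sum_list Cs"
      by auto
    moreover from this have "a + (b + c) \<in> sum_list Bs"
      unfolding Bs sum_list.Cons by (intro set_plus_intro)
    ultimately have "a + (b + c) = Poly_Mapping.single off 1"
      using 0(3) by auto
    then have "monom_degree (a + (b + c)) = 1"
      by (simp add: monom_degree_def)
    moreover have "a \<noteq> 0" "b \<noteq> 0"
      using 0(2)[of A] 0(2)[of B] \<open>a \<in> A\<close> \<open>b \<in> B\<close> unfolding Bs by auto
    ultimately show ?thesis
      by (simp add: monom_degree_add flip: monom_degree_eq_0_iff)
  qed
next
  case (Suc k)
  have fin: "finite (sum_list Bs)"
    using finite_subset[OF Suc.prems(3) finite_tree_monoms] .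
  consider "Bs = []" | A where "Bs = [A]" | A B Cs where "Bs = A # B # Cs"
    by (metis neq_Nil_conv)
  then show ?case
  proof cases
    case 1
    with Suc.prems(3) have "0 \<in> tree_monoms r (Suc k) off"
      by simp
    then show ?thesis
      using tree_monoms_keys_nonempty[of 0 r "Suc k" off] by (simp del: tree_monoms.simps)
  next
    case 2
    have "card (sum_list Bs) * r \<le> card (tree_monoms r (Suc k) off) * r"
      by (intro mult_right_mono card_mono finite_tree_monoms Suc.prems) simp
    also have "\<dots> = r ^ 2 ^ Suc k"
      using card_tree_monoms[of r "Suc k" off] by (simp only: mult.commute)
    finally show ?thesis
      using 2 by simp
  next
    \<comment> \<open>With at least two factors the summand at the root is fixed, so the product
      embeds into the sum of two subtrees and the induction hypothesis applies to its restriction to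
      each.\<close>
    case 3
    let ?X = "sum_list Bs"
    have "A \<noteq> {}" "0 \<notin> A" "B + sum_list Cs \<noteq> {}"
      using Suc.prems(1,2) sum_list_sets_nonempty[of "B # Cs"] 3 by auto
    moreover have "0 \<notin> B + sum_list Cs"
    proof
      assume "0 \<in> B + sum_list Cs"
      then obtain b c where "b \<in> B" "0 = b + c"
        by (elim set_plus_elim)
      then have "monom_degree b = 0"
        using monom_degree_add[of b c] by simp
      with \<open>b \<in> B\<close> Suc.prems(2)[of B] 3 show False
        by (simp add: monom_degree_eq_0_iff)
    qed
    ultimately obtain i where i: "?X \<subseteq> tree_monoms r k (off + 2 * i * (2 * r) ^ k) +
        tree_monoms r k (off + (2 * i + 1) * (2 * r) ^ k)"
      using sumset_subset_branch[of A "B + sum_list Cs" r k off] Suc.prems(3) 3 by auto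
    define V where "V = {off + 2 * i * (2 * r) ^ k..<off + 2 * i * (2 * r) ^ k + (2 * r) ^ k}"
    define Ds where "Ds U = filter (\<lambda>B. B \<noteq> {0}) (map ((`) (monom_restrict U)) Bs)" for U
    have sum_Ds: "sum_list (Ds U) = monom_restrict U ` ?X" for U
      by (simp add: Ds_def sum_list_filter_zero_set image_monom_restrict_sum_list)
    have half: "card (monom_restrict U ` ?X) * r ^ length (Ds U) \<le> r ^ 2 ^ k"
      if sub: "monom_restrict U ` ?X \<subseteq> tree_monoms r k off'" for U off'
    proof -
      have "homogeneous (2 ^ k) (sum_list (Ds U))"
        using homogeneous_tree_monoms[of k r off'] sub
        unfolding sum_Ds homogeneous_def by blast
      moreover have ne: "D \<noteq> {}" if "D \<in> set (Ds U)" for D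
        using that Suc.prems(1) by (auto simp: Ds_def)
      ultimately obtain e where e: "homogeneous (e D) D" if "D \<in> set (Ds U)" for D
        by (rule homogeneous_sum_listE) blast+
      \<comment> \<open>The restricted product is homogeneous, hence so is each factor; one that is
        not \<open>{0}\<close> therefore avoids the constant monomial.\<close>
      have "0 \<notin> D" if D: "D \<in> set (Ds U)" for D
        using homogeneous_zero_notin[OF e[OF D]] D by (simp add: Ds_def)
      with ne Suc.IH[of "Ds U" off'] sub show ?thesis
        by (simp add: sum_Ds)
    qed
    have restr: "monom_restrict V ` ?X \<subseteq> tree_monoms r k (off + 2 * i * (2 * r) ^ k)"
      "monom_restrict (- V) ` ?X \<subseteq> tree_monoms r k (off + (2 * i + 1) * (2 * r) ^ k)"
    proof -
      have "monom_restrict V m \<in> tree_monoms r k (off + 2 * i * (2 * r) ^ k) \<and>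
          monom_restrict (- V) m \<in> tree_monoms r k (off + (2 * i + 1) * (2 * r) ^ k)" if m: "m \<in> ?X" for m
      proof -
        obtain a b where "m = a + b" "a \<in> tree_monoms r k (off + 2 * i * (2 * r) ^ k)"
          "b \<in> tree_monoms r k (off + (2 * i + 1) * (2 * r) ^ k)"
          using subsetD[OF i m] by (rule set_plus_elim)
        then show ?thesis
          using monom_restrict_branch[of a r k off i b] unfolding V_def by metis
      qed
      then show "monom_restrict V ` ?X \<subseteq> tree_monoms r k (off + 2 * i * (2 * r) ^ k)"
        "monom_restrict (- V) ` ?X \<subseteq> tree_monoms r k (off + (2 * i + 1) * (2 * r) ^ k)"
        by blast+
    qed
    have "inj_on (\<lambda>m. (monom_restrict V m, monom_restrict (- V) m)) ?X"
      by (rule inj_onI) (metis monom_restrict_Compl_add prod.inject)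
    moreover have "(\<lambda>m. (monom_restrict V m, monom_restrict (- V) m)) ` ?X \<subseteq>
        monom_restrict V ` ?X \<times> monom_restrict (- V) ` ?X"
      by auto
    ultimately have "card ?X \<le> card (monom_restrict V ` ?X \<times> monom_restrict (- V) ` ?X)"
      using fin by (intro card_inj_on_le) auto
    then have card: "card ?X \<le> card (monom_restrict V ` ?X) * card (monom_restrict (- V) ` ?X)"
      by (simp only: card_cartesian_product)
    \<comment> \<open>A nonconstant element stays nonconstant on at least one side, so each factor
      survives in at least one of the two restricted products.\<close>
    have "length Bs \<le> length (Ds V) + length (Ds (- V))"
    proof -
      have "monom_restrict V ` C \<noteq> {0} \<or> monom_restrict (- V) ` C \<noteq> {0}" if C: "C \<in> set Bs" for C
      proof -
        obtain c where "c \<in> C" "c \<noteq> 0"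
          using Suc.prems(1)[OF C] Suc.prems(2)[OF C] by auto
        then show ?thesis
          using monom_restrict_Compl_add[of V c] by (metis add_0 image_eqI singletonD)
      qed
      then have "length Cs \<le> length (filter (\<lambda>B. B \<noteq> {0}) (map ((`) (monom_restrict V)) Cs)) +
          length (filter (\<lambda>B. B \<noteq> {0}) (map ((`) (monom_restrict (- V))) Cs))"
        if "set Cs \<subseteq> set Bs" for Cs
        using that by (induction Cs) auto
      then show ?thesis
        unfolding Ds_def by blast
    qed
    then have "card ?X * r ^ length Bs \<le>
        (card (monom_restrict V ` ?X) * card (monom_restrict (- V) ` ?X)) *
        r ^ (length (Ds V) + length (Ds (- V)))"
      using assms(1) by (intro mult_mono card power_increasing) auto
    also have "\<dots> = (card (monom_restrict V ` ?X) * r ^ length (Ds V)) *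
        (card (monom_restrict (- V) ` ?X) * r ^ length (Ds (- V)))"
      by (simp add: power_add)
    also have "\<dots> \<le> r ^ 2 ^ k * r ^ 2 ^ k"
      by (intro mult_mono half[OF restr(1)] half[OF restr(2)]) auto
    finally show ?thesis
      by (simp add: mult_2 power_add)
  qed
qed

section \<open>Covering a shallow formula by products\<close>

lemma monoms_nonempty: "formula_over n f \<Longrightarrow> monoms f \<noteq> {}"
proof (induction f rule: num_leaves.induct)
  case (3 cs)
  then obtain c f where f: "(c, f) \<in> set cs"
    by (cases cs) auto
  with 3 have "monoms f \<noteq> {}"
    by auto
  with f show ?case
    by (force simp: monoms_Plus)
next
  case (4 cs)
  then show ?case
    unfolding monoms_Times by (intro sum_list_sets_nonempty) auto
qed auto

lemma num_leaves_pos: "formula_over n f \<Longrightarrow> num_leaves f > 0"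
proof (induction f rule: num_leaves.induct)
  case (3 cs)
  then show ?case
    by (cases cs) auto
next
  case (4 cs)
  then show ?case
    by (cases cs) auto
qed auto

lemma depth_child:
  assumes "(c, f) \<in> set cs"
  shows "depth f < depth (Plus cs)" "depth f < depth (Times cs)"
proof -
  have "depth f \<le> Max (insert 0 (set (map (\<lambda>(c, f). depth f) cs)))"
    using assms by (intro Max_ge) force+
  then show "depth f < depth (Plus cs)" "depth f < depth (Times cs)"
    by simp_all
qed

text \<open>
  Follow from the root into a child of largest degree at every product gate: the leaf reached
  determines one product of the cover, whose factors are the siblings along the path. A product gate
  with \<open>t\<close> non-constant children divides the degree by at most \<open>t\<close> and contributes
  \<open>t - 1\<close> factors.
\<close>

lemma formula_cover:
  fixes C K :: real
  assumes tangent: "\<And>t::nat. t \<ge> 1 \<Longrightarrow> C * ln (real t) \<le> real t - 1 + K"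
    and "C \<ge> 0" "K \<ge> 0" "formula_over n f" "homogeneous D (monoms f)" "D > 0"
  shows "\<exists>Ls. length Ls \<le> num_leaves f \<and> monoms f \<subseteq> (\<Union>L\<in>set Ls. sum_list L) \<and>
    (\<forall>L\<in>set Ls. sum_list L \<subseteq> monoms f \<and> (\<forall>B\<in>set L. B \<noteq> {} \<and> 0 \<notin> B) \<and>
       C * ln (real D) - K * real (depth f) \<le> real (length L) - 1)"
  using assms(4-6)
proof (induction f arbitrary: D rule: num_leaves.induct)
  case (1 i)
  then have "D = 1"
    by (simp add: homogeneous_def monom_degree_def)
  then show ?case
    by (intro exI[of _ "[[{Poly_Mapping.single i 1}]]"]) (simp flip: monom_degree_eq_0_iff, simp add: monom_degree_def)
next
  case 2
  then show ?case
    by (simp add: homogeneous_def)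
next
  case (3 cs)
  let ?P = "\<lambda>f Ls. length Ls \<le> num_leaves f \<and> monoms f \<subseteq> (\<Union>L\<in>set Ls. sum_list L) \<and>
    (\<forall>L\<in>set Ls. sum_list L \<subseteq> monoms f \<and> (\<forall>B\<in>set L. B \<noteq> {} \<and> 0 \<notin> B) \<and>
       C * ln (real D) - K * real (depth f) \<le> real (length L) - 1)"
  have "\<exists>Ls. ?P (snd x) Ls" if x: "x \<in> set cs" for x
  proof -
    obtain c f where cf: "x = (c, f)"
      by force
    have "formula_over n f" "homogeneous D (monoms f)"
      using 3(2,3) x by (auto simp: cf homogeneous_def monoms_Plus)
    then show ?thesis
      using 3(1)[OF x cf[symmetric]] 3(4) by (simp add: cf)
  qed
  then obtain G where G: "?P (snd x) (G x)" if "x \<in> set cs" for x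
    by metis
  \<comment> \<open>All children have degree \<open>D\<close>, so their covers are simply joined;
    the added level of depth only weakens the bound.\<close>
  have "?P (Plus cs) (concat (map G cs))"
  proof (intro conjI ballI)
    show "length (concat (map G cs)) \<le> num_leaves (Plus cs)"
      using G by (auto simp: length_concat comp_def case_prod_unfold intro!: sum_list_mono)
    show "monoms (Plus cs) \<subseteq> (\<Union>L\<in>set (concat (map G cs)). sum_list L)"
      using G by (fastforce simp: monoms_Plus)
    fix L
    assume "L \<in> set (concat (map G cs))"
    then obtain c f where f: "(c, f) \<in> set cs" "L \<in> set (G (c, f))"
      by auto
    have "monoms f \<subseteq> monoms (Plus cs)"
      using f(1) by (force simp: monoms_Plus)
    then show "sum_list L \<subseteq> monoms (Plus cs)"
      using G[OF f(1)] f(2) by (metis snd_conv subset_trans)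
    show "B \<noteq> {}" "0 \<notin> B" if "B \<in> set L" for B
      using G[OF f(1)] f(2) that by auto
    have "K * real (depth f) \<le> K * real (depth (Plus cs))"
      using depth_child(1)[OF f(1)] \<open>K \<ge> 0\<close> by (intro mult_left_mono) simp_all
    moreover have "C * ln (real D) - K * real (depth f) \<le> real (length L) - 1"
      using G[OF f(1)] f(2) by simp
    ultimately show "C * ln (real D) - K * real (depth (Plus cs)) \<le> real (length L) - 1"
      by linarith
  qed
  then show ?case
    by blast
next
  case (4 cs)
  let ?m = "\<lambda>(c, f). monoms f"
  have ne: "B \<noteq> {}" if "B \<in> set (map ?m cs)" for B
    using 4(2) that monoms_nonempty by fastforce
  obtain e where e: "\<And>B. B \<in> set (map ?m cs) \<Longrightarrow> homogeneous (e B) B"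
    and D: "D = sum_list (map e (map ?m cs))"
    using homogeneous_sum_listE[of D "map ?m cs"] 4(3) ne unfolding monoms_Times by blast
  have "Max (e ` set (map ?m cs)) \<in> e ` set (map ?m cs)"
    using 4(2) by (intro Max_in) auto
  then obtain A where A: "A \<in> set (map ?m cs)" "Max (e ` set (map ?m cs)) = e A"
    by (rule imageE)
  obtain c f where f: "(c, f) \<in> set cs" "A = monoms f"
    using A(1) by auto
  have max: "e B \<le> e (monoms f)" if "B \<in> set (map ?m cs)" for B
    using Max_ge[of "e ` set (map ?m cs)" "e B"] that unfolding A(2) f(2) by simp
  obtain us vs where cs: "cs = us @ (c, f) # vs"
    using f(1) by (auto simp: in_set_conv_decomp)
  \<comment> \<open>\<open>As\<close> holds the siblings of the chosen child, \<open>Rs\<close>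
    those that are not constant, and \<open>t\<close> counts the latter plus the chosen
    child.\<close>
  define As where "As = map ?m (us @ vs)"
  define Rs where "Rs = filter (\<lambda>B. B \<noteq> {0}) As"
  define d where "d = e (monoms f)"
  define t where "t = Suc (length Rs)"
  have As: "set As \<subseteq> set (map ?m cs)"
    by (auto simp: As_def cs)
  have "sum_list (map e As) \<le> d * length Rs"
    unfolding Rs_def using As
  proof (induction As)
    case (Cons B Bs)
    have "homogeneous (e B) B"
      using Cons.prems e by auto
    then have "e B = 0" if "B = {0}"
      using that by (simp add: homogeneous_def)
    moreover have "e B \<le> d"
      using Cons.prems max by (auto simp: d_def)
    ultimately show ?case
      using Cons by auto
  qed simp
  then have "D \<le> d * t"
    unfolding D by (simp add: cs As_def d_def t_def)
  with 4(4) have "d > 0" "t > 0"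
    by (auto simp: t_def intro: gr0I)
  \<comment> \<open>The loss of degree by a factor \<open>t\<close> is paid for by the
    \<open>t - 1\<close> new factors and one \<open>K\<close> for this level of depth.\<close>
  have "C * ln (real D) \<le> C * ln (real d * real t)"
    using \<open>D \<le> d * t\<close> 4(4) \<open>C \<ge> 0\<close> by (intro mult_left_mono ln_mono) (auto simp flip: of_nat_mult)
  also have "\<dots> = C * ln (real d) + C * ln (real t)"
    using \<open>d > 0\<close> \<open>t > 0\<close> by (simp add: ln_mult algebra_simps)
  also have "\<dots> \<le> C * ln (real d) + (real t - 1 + K)"
    using tangent[of t] \<open>t > 0\<close> by simp
  finally have ln_D: "C * ln (real D) \<le> C * ln (real d) + real t - 1 + K"
    by simp
  have depth: "K + K * real (depth f) \<le> K * real (depth (Times cs))"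
  proof -
    have "K * (1 + real (depth f)) \<le> K * real (depth (Times cs))"
      using depth_child(2)[OF f(1)] \<open>K \<ge> 0\<close> by (intro mult_left_mono) simp_all
    then show ?thesis
      by (simp add: algebra_simps)
  qed
  have "homogeneous d (monoms f)"
    unfolding d_def by (rule e) (use f(1) in force)
  moreover have "formula_over n f"
    using 4(2) f(1) by auto
  ultimately obtain Ls where len: "length Ls \<le> num_leaves f"
    and cover: "monoms f \<subseteq> (\<Union>L\<in>set Ls. sum_list L)"
    and Ls: "\<And>L. L \<in> set Ls \<Longrightarrow> sum_list L \<subseteq> monoms f"
      "\<And>L B. L \<in> set Ls \<Longrightarrow> B \<in> set L \<Longrightarrow> B \<noteq> {} \<and> 0 \<notin> B"
      "\<And>L. L \<in> set Ls \<Longrightarrow> C * ln (real d) - K * real (depth f) \<le> real (length L) - 1"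
    using 4(1)[OF f(1) refl, of d] \<open>d > 0\<close> by auto
  have monoms: "monoms (Times cs) = monoms f + sum_list As"
    unfolding monoms_Times cs by (simp add: As_def add.left_commute)
  have sum: "sum_list (L @ Rs) = sum_list L + sum_list As" for L
    unfolding sum_list_append Rs_def sum_list_filter_zero_set ..
  show ?case
  \<comment> \<open>Appending the siblings to each product leaves the number of products unchanged,
    so the leaves of the chosen child alone suffice to count them.\<close>
  proof (intro exI[of _ "map (\<lambda>L. L @ Rs) Ls"] conjI ballI)
    show "length (map (\<lambda>L. L @ Rs) Ls) \<le> num_leaves (Times cs)"
      using len by (simp add: cs)
    show "monoms (Times cs) \<subseteq> (\<Union>L\<in>set (map (\<lambda>L. L @ Rs) Ls). sum_list L)"
    proof
      fix x
      assume "x \<in> monoms (Times cs)"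
      then obtain a b where ab: "x = a + b" "a \<in> monoms f" "b \<in> sum_list As"
        unfolding monoms by (rule set_plus_elim)
      with cover obtain L where "L \<in> set Ls" "a \<in> sum_list L"
        by blast
      with ab show "x \<in> (\<Union>L\<in>set (map (\<lambda>L. L @ Rs) Ls). sum_list L)"
        using sum[of L] by (auto intro!: bexI[of _ L] set_plus_intro simp del: sum_list_append)
    qed
    fix L'
    assume "L' \<in> set (map (\<lambda>L. L @ Rs) Ls)"
    then obtain L where L: "L \<in> set Ls" "L' = L @ Rs"
      by auto
    show "sum_list L' \<subseteq> monoms (Times cs)"
      unfolding L(2) sum monoms by (intro set_plus_mono2 Ls L(1)) simp
    have "B \<noteq> {} \<and> 0 \<notin> B" if "B \<in> set Rs" for B
      using that As ne[of B] homogeneous_zero_notin[OF e, of B] by (auto simp: Rs_def simp del: set_map)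
    then show "B \<noteq> {}" "0 \<notin> B" if "B \<in> set L'" for B
      using that Ls(2)[OF L(1), of B] unfolding L(2) by auto
    have "real (length L') = real (length L) + real t - 1"
      by (simp add: L(2) t_def)
    then show "C * ln (real D) - K * real (depth (Times cs)) \<le> real (length L') - 1"
      using Ls(3)[OF L(1)] ln_D depth by linarith
  qed
qed

text \<open>Counting: \<open>r ^ (2 ^ k - 1)\<close> monomials are covered by at most
  \<open>num_leaves f\<close> products, each with at least \<open>q + 1\<close> factors and so at
  most \<open>r powr (2 ^ k - 1 - q)\<close> elements.\<close>

lemma num_leaves_lower_bound:
  fixes C K :: real
  assumes "\<And>t::nat. t \<ge> 1 \<Longrightarrow> C * ln (real t) \<le> real t - 1 + K" "C \<ge> 0" "K \<ge> 0"
    and "formula_over n f" "monoms f = tree_monoms r k off" "r > 0"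
  shows "real r powr (C * ln (2 ^ k) - K * real (depth f)) \<le> real (num_leaves f)"
proof -
  \<comment> \<open>The exponent is real and may be negative, hence \<open>powr\<close>.\<close>
  define q where "q = C * ln (2 ^ k) - K * real (depth f)"
  obtain Ls where len: "length Ls \<le> num_leaves f"
    and cover: "monoms f \<subseteq> (\<Union>L\<in>set Ls. sum_list L)"
    and Ls: "\<And>L. L \<in> set Ls \<Longrightarrow> sum_list L \<subseteq> monoms f"
      "\<And>L B. L \<in> set Ls \<Longrightarrow> B \<in> set L \<Longrightarrow> B \<noteq> {} \<and> 0 \<notin> B"
      "\<And>L. L \<in> set Ls \<Longrightarrow> q \<le> real (length L) - 1"
    using formula_cover[OF assms(1-4), of "2 ^ k"] homogeneous_tree_monoms[of k r off]
    by (auto simp: assms(5) q_def)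
  have exponent: "real r powr 2 ^ k = real r ^ 2 ^ k"
    using assms(6) powr_realpow[of "real r" "2 ^ k"] by simp
  have card: "real (card (sum_list L)) \<le> real r powr (2 ^ k - 1 - q)" if L: "L \<in> set Ls" for L
  proof -
    have "card (sum_list L) * r ^ length L \<le> r ^ 2 ^ k"
      using Ls(1,2)[OF L] assms(5,6) by (intro card_sumset_tree_monoms) auto
    then have "real (card (sum_list L) * r ^ length L) \<le> real (r ^ 2 ^ k)"
      by (simp only: of_nat_le_iff)
    then have "real (card (sum_list L)) * real r powr real (length L) \<le> real r powr 2 ^ k"
      using assms(6) by (simp add: powr_realpow exponent)
    then have "real (card (sum_list L)) \<le> real r powr (2 ^ k - real (length L))"
      using assms(6) by (simp add: powr_diff field_simps)
    also have "\<dots> \<le> real r powr (2 ^ k - 1 - q)"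
      using Ls(3)[OF L] assms(6) by (intro powr_mono) auto
    finally show ?thesis .
  qed
  have "real r * real (card (tree_monoms r k off)) = real r powr 2 ^ k"
    unfolding exponent using card_tree_monoms[of r k off] by (metis of_nat_mult of_nat_power)
  then have "real r powr (2 ^ k - 1) = real (card (monoms f))"
    using assms(6) by (simp add: powr_diff field_simps assms(5))
  also have "\<dots> \<le> real (card (\<Union>L\<in>set Ls. sum_list L))"
    using cover Ls(1) finite_monoms[of f] by (intro of_nat_mono card_mono) (auto intro: finite_subset)
  also have "\<dots> \<le> (\<Sum>L\<in>set Ls. real (card (sum_list L)))"
    using card_UN_le[of "set Ls" sum_list] by (simp flip: of_nat_sum)
  also have "\<dots> \<le> real (card (set Ls)) * real r powr (2 ^ k - 1 - q)"
    using sum_bounded_above[of "set Ls" "\<lambda>L. real (card (sum_list L))"] card by auto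
  also have "\<dots> \<le> real (num_leaves f) * real r powr (2 ^ k - 1 - q)"
    using len card_length[of Ls] by (intro mult_right_mono) auto
  finally have "real r powr (2 ^ k - 1) \<le> real (num_leaves f) * real r powr (2 ^ k - 1 - q)" .
  moreover have "real r powr (2 ^ k - 1) = real r powr q * real r powr (2 ^ k - 1 - q)"
    by (simp flip: powr_add)
  ultimately show ?thesis
    using assms(6) by (simp flip: q_def)
qed

section \<open>Choice of parameters\<close>

lemma formula_over_tree:
  assumes "r > 0" "off \<ge> 1" "off + (2 * r) ^ k \<le> Suc n"
  shows "formula_over n (tree r k off :: 'a::field formula)"
  using assms(2,3)
proof (induction k arbitrary: off)
  case (Suc k)
  have "formula_over n (tree r k (off + j * (2 * r) ^ k) :: 'a formula)" if "j < 2 * r" for j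
  proof (rule Suc.IH)
    have "(j + 1) * (2 * r) ^ k \<le> (2 * r) * (2 * r) ^ k"
      using that by (intro mult_right_mono) auto
    then show "off + j * (2 * r) ^ k + (2 * r) ^ k \<le> Suc n"
      using Suc.prems(2) by (simp add: algebra_simps)
  qed (use Suc.prems(1) in simp)
  from this[of "2 * i" for i] this[of "2 * i + 1" for i]
  have "formula_over n (tree r k (off + 2 * i * (2 * r) ^ k) :: 'a formula)"
    "formula_over n (tree r k (off + (2 * i + 1) * (2 * r) ^ k) :: 'a formula)" if "i < r" for i
    using that by simp_all
  then show ?case
    using assms(1) by simp
qed simp

lemma num_leaves_tree: "num_leaves (tree r k off) = (2 * r) ^ k"
  by (induction k arbitrary: off) (simp_all add: comp_def sum_list_triv)

lemma depth_tree: "depth (tree r k off) \<le> 2 * k"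
proof (induction k arbitrary: off)
  case (Suc k)
  then show ?case
    by (auto simp: le_diff_conv)
qed simp

lemma total_degree_le:
  "homogeneous D (Poly_Mapping.keys p) \<Longrightarrow> total_degree p \<le> D"
  by (auto simp: total_degree_def homogeneous_def)

text \<open>\<open>k\<close> is the binary logarithm of \<open>d\<close> rounded down, and
  \<open>r\<close> is the largest value that fits. The bound \<open>d * d \<le> n\<close> gives
  \<open>4 ^ k \<le> n\<close>, so \<open>r = 2\<close> fits; maximality gives
  \<open>n < (2 * Suc r) ^ k\<close>, and \<open>2 * Suc r \<le> r ^ 3\<close>.\<close>

lemma tree_parameters:
  assumes "d > 0" "real d \<le> sqrt (real n)"
  obtains k r :: nat where "2 ^ k \<le> d" "d < 2 ^ Suc k" "r \<ge> 2" "(2 * r) ^ k \<le> n"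
    "k > 0 \<Longrightarrow> n \<le> (r ^ 3) ^ k"
proof -
  obtain k where k: "2 ^ k \<le> d" "d < 2 ^ Suc k"
    using ex_power_ivl1[of 2 d] assms(1) by auto
  have "(2 * 2) ^ k = (2 ^ k * 2 ^ k :: nat)"
    by (rule power_mult_distrib)
  also have "\<dots> \<le> d * d"
    using k(1) by (intro mult_mono) auto
  also have "\<dots> \<le> n"
  proof -
    have "real d ^ 2 \<le> real n"
      using assms(2) by (metis of_nat_0_le_iff real_sqrt_le_iff real_sqrt_abs abs_of_nat)
    then show ?thesis
      by (simp add: power2_eq_square flip: of_nat_mult)
  qed
  finally have two: "(2 * 2) ^ k \<le> n" .
  show ?thesis
  proof (cases "k = 0")
    \<comment> \<open>For \<open>k = 0\<close> every \<open>r\<close> fits and there is no largest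
      one; 2 is as good as any.\<close>
    case True
    with k two that[of k 2] show ?thesis
      by simp
  next
    case False
    define P where "P r \<longleftrightarrow> (2 * r) ^ k \<le> n" for r
    have bound: "r \<le> n" if "P r" for r
    proof -
      have "r \<le> (2 * r) ^ k"
        using False self_le_power[of "2 * r" k] by (cases "r = 0") auto
      with that show ?thesis
        by (simp add: P_def)
    qed
    define r where "r = (GREATEST r. P r)"
    have "P 2"
      using two by (simp add: P_def)
    then have r: "P r" "r \<ge> 2" "\<not> P (Suc r)"
      using GreatestI_nat[of P 2 n] Greatest_le_nat[of P _ n] bound unfolding r_def
      by (blast, blast, metis Suc_n_not_le_n)
    have "2 * Suc r \<le> r ^ 3"
    proof -
      have "2 * 2 * r \<le> r * r * r"
        using r(2) by (intro mult_mono) auto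
      moreover have "2 * Suc r \<le> 2 * 2 * r"
        using r(2) by simp
      ultimately show ?thesis
        unfolding power3_eq_cube by linarith
    qed
    then have "(2 * Suc r) ^ k \<le> (r ^ 3) ^ k"
      by (intro power_mono) auto
    with r(3) have "n \<le> (r ^ 3) ^ k"
      by (simp add: P_def)
    with k r that[of k r] show ?thesis
      by (simp add: P_def)
  qed
qed

text \<open>Passes from every fixed power \<open>G\<close>, each with its own threshold, to one
  diverging exponent: the logarithm to base \<open>n\<close> of the least size of a good
  object.\<close>

lemma superpolynomial_exponent:
  fixes good :: "nat \<Rightarrow> 'b \<Rightarrow> bool" and size :: "'b \<Rightarrow> nat"
  assumes pos: "\<And>n x. good n x \<Longrightarrow> size x > 0"
    and super: "\<And>G::real. G \<ge> 0 \<Longrightarrow> eventually (\<lambda>n. \<forall>x. good n x \<longrightarrow> real n powr G \<le> real (size x)) sequentially"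
  shows "\<exists>g. filterlim g at_top sequentially \<and> (\<forall>n\<ge>1. \<forall>x. good n x \<longrightarrow> real n powr g n \<le> real (size x))"
proof -
  define m where "m n = (LEAST s. \<exists>x. good n x \<and> size x = s)" for n
  \<comment> \<open>Where no object is good, the value \<open>real n\<close> only has to keep
    \<open>g\<close> diverging.\<close>
  define g where "g n = (if \<exists>x. good n x then ln (real (m n)) / ln (real n) else real n)" for n
  have m: "\<exists>x. good n x \<and> size x = m n" if "good n x" for n x
    unfolding m_def by (rule LeastI) (use that in blast)
  have m_le: "m n \<le> size x" if "good n x" for n x
    unfolding m_def by (rule Least_le) (use that in blast)
  have m_pos: "m n > 0" if "good n x" for n x
    using m[OF that] pos by metis
  have "eventually (\<lambda>n. G \<le> g n) sequentially" if "G \<ge> 0" for G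
    using super[OF that] eventually_ge_at_top[of 2] eventually_ge_at_top[of "nat \<lceil>G\<rceil>"]
  proof eventually_elim
    case (elim n)
    show ?case
    proof (cases "\<exists>x. good n x")
      case True
      then obtain x where x: "good n x" "size x = m n"
        using m by blast
      with elim have "real n powr G \<le> real (m n)"
        by metis
      then have "ln (real n powr G) \<le> ln (real (m n))"
        using elim m_pos[OF x(1)] by (subst ln_le_cancel_iff) auto
      with elim True show ?thesis
        by (simp add: g_def ln_powr field_simps)
    next
      case False
      with elim show ?thesis
        by (simp add: g_def)
    qed
  qed
  then have "filterlim g at_top sequentially"
    by (subst filterlim_at_top_ge[where c = 0]) auto
  moreover have "real n powr g n \<le> real (size x)" if "n \<ge> 1" "good n x" for n x
  proof (cases "n = 1")
    \<comment> \<open>At \<open>n = 1\<close> the logarithmic quotient has denominator 0, but every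
      power of 1 is 1 and sizes are positive.\<close>
    case True
    then show ?thesis
      using pos[OF that(2)] by simp
  next
    case False
    with that have "real n powr g n = real (m n)"
      using m_pos[OF that(2)] by (auto simp: g_def powr_def)
    with m_le[OF that(2)] show ?thesis
      by simp
  qed
  ultimately show ?thesis
    by blast
qed

text \<open>The concave function \<open>C * ln t\<close> lies below its tangent at
  \<open>t = C\<close>, which has slope 1. The absolute value makes the constant
  nonnegative.\<close>

lemma ln_tangent:
  fixes C :: real
  assumes "C > 0" "t > 0"
  shows "C * ln t \<le> t - 1 + \<bar>C * ln C - C + 1\<bar>"
proof -
  have "ln (t / C) \<le> t / C - 1"
    using assms by (intro ln_le_minus_one) simp
  then have "C * ln (t / C) \<le> C * (t / C - 1)"
    using assms by (intro mult_left_mono) auto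
  then have "C * ln t \<le> t - 1 + (C * ln C - C + 1)"
    using assms by (simp add: ln_div algebra_simps)
  then show ?thesis
    by linarith
qed

theorem theorem1p3:
  fixes d :: "nat \<Rightarrow> nat"
  assumes "filterlim d at_top sequentially"
    and "\<And>n. n \<ge> 1 \<Longrightarrow> real (d n) \<le> sqrt (real n)"
  shows "\<exists>(F :: nat \<Rightarrow> 'a::field formula) (P :: nat \<Rightarrow> 'a mpoly).
    (\<forall>n\<ge>1. formula_over n (F n) \<and> monotone_formula (F n) \<and> num_leaves (F n) \<le> n \<and>
       formula_poly (F n) = P n \<and> total_degree (P n) \<le> d n) \<and>
    (\<lambda>n. real (depth (F n))) \<in> O(\<lambda>n. ln (real (d n))) \<and>
    (\<forall>\<Delta> :: nat \<Rightarrow> nat. (\<lambda>n. real (\<Delta> n)) \<in> o(\<lambda>n. ln (real (d n))) \<longrightarrow>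
       (\<exists>g :: nat \<Rightarrow> real. filterlim g at_top sequentially \<and>
          (\<forall>n\<ge>1. \<forall>F' :: 'a formula.
             formula_over n F' \<and> monotone_formula F' \<and> formula_poly F' = P n \<and> depth F' \<le> \<Delta> n
             \<longrightarrow> real (num_leaves F') \<ge> real n powr g n)))"
proof -
  define Q where "Q n k r \<longleftrightarrow> 2 ^ k \<le> d n \<and> d n < 2 ^ Suc k \<and> r \<ge> 2 \<and> (2 * r) ^ k \<le> n \<and>
      (k > 0 \<longrightarrow> n \<le> (r ^ 3) ^ k)" for n k r :: nat
  have "\<exists>k r. Q n k r" if "n \<ge> 1" "d n > 0" for n
    using tree_parameters[OF that(2) assms(2)[OF that(1)]] unfolding Q_def by metis
  then obtain k r where Q: "Q n (k n) (r n)" if "n \<ge> 1" "d n > 0" for n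
    by metis
  have kr: "2 ^ k n \<le> d n" "d n < 2 ^ Suc (k n)" "r n \<ge> 2"
    "(2 * r n) ^ k n \<le> n" "k n > 0 \<Longrightarrow> n \<le> (r n ^ 3) ^ k n" if "n \<ge> 1" "d n > 0" for n
    using Q[OF that] unfolding Q_def by simp_all
  \<comment> \<open>\<open>d n\<close> may be 0 for finitely many \<open>n\<close>; there the
    constant formula has the required degree 0.\<close>
  define F :: "nat \<Rightarrow> 'a formula" where "F n = (if d n = 0 then One else tree (r n) (k n) 1)" for n
  have keys: "Poly_Mapping.keys (formula_poly (F n)) = tree_monoms (r n) (k n) 1" if "d n > 0" for n
    using that monotone_formula_keys[OF monotone_tree] by (simp add: F_def monoms_tree)
  have d_ge_2: "eventually (\<lambda>n. d n \<ge> 2) sequentially"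
    using assms(1) by (simp add: filterlim_at_top)
  have F: "formula_over n (F n) \<and> monotone_formula (F n) \<and> num_leaves (F n) \<le> n \<and>
      total_degree (formula_poly (F n)) \<le> d n" if n: "n \<ge> 1" for n
  proof (cases "d n = 0")
    case True
    with n show ?thesis
      by (simp add: F_def monotone_formula_def formula_poly_leaf total_degree_def)
  next
    case False
    then have "d n > 0"
      by simp
    note kr = kr[OF n this]
    have "total_degree (formula_poly (F n)) \<le> 2 ^ k n"
      by (rule total_degree_le) (simp only: keys[OF \<open>d n > 0\<close>] homogeneous_tree_monoms)
    with kr False show ?thesis
      by (simp add: F_def formula_over_tree num_leaves_tree monotone_tree)
  qed
  have "eventually (\<lambda>n. norm (real (depth (F n))) \<le> (2 / ln 2) * norm (ln (real (d n)))) sequentially"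
    using eventually_ge_at_top[of 1] d_ge_2
  proof eventually_elim
    case (elim n)
    have "real (2 ^ k n) \<le> real (d n)"
      using kr(1)[of n] elim unfolding of_nat_le_iff by simp
    then have "ln (2 ^ k n) \<le> ln (real (d n))"
      by (intro ln_mono) simp_all
    then have "real (k n) \<le> ln (real (d n)) / ln 2"
      by (simp add: ln_realpow field_simps)
    moreover have "real (depth (F n)) \<le> 2 * real (k n)"
      using depth_tree[of "r n" "k n" 1, where 'a = 'a] elim by (simp add: F_def)
    ultimately show ?case
      using elim by simp
  qed
  then have depth: "(\<lambda>n. real (depth (F n))) \<in> O(\<lambda>n. ln (real (d n)))"
    by (rule bigoI)
  have lower: "\<exists>g :: nat \<Rightarrow> real. filterlim g at_top sequentially \<and>
      (\<forall>n\<ge>1. \<forall>F' :: 'a formula.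
        formula_over n F' \<and> monotone_formula F' \<and> formula_poly F' = formula_poly (F n) \<and> depth F' \<le> \<Delta> n
        \<longrightarrow> real (num_leaves F') \<ge> real n powr g n)"
    if \<Delta>: "(\<lambda>n. real (\<Delta> n)) \<in> o(\<lambda>n. ln (real (d n)))" for \<Delta> :: "nat \<Rightarrow> nat"
  proof (rule superpolynomial_exponent)
    show "num_leaves f > 0" if "formula_over n f \<and> monotone_formula f \<and>
        formula_poly f = formula_poly (F n) \<and> depth f \<le> \<Delta> n" for n and f :: "'a formula"
      using that num_leaves_pos by blast
    fix G :: real
    assume G: "G \<ge> 0"
    \<comment> \<open>Chosen so that \<open>C * ln (2 ^ k) = (3 * G + 1) * k\<close>: the part
      \<open>3 * G * k\<close> matches \<open>n \<le> r ^ (3 * k)\<close>, and the spare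
      \<open>k\<close> absorbs \<open>K * \<Delta> n\<close>.\<close>
    define C where "C = (3 * G + 1) / ln 2"
    define K where "K = \<bar>C * ln C - C + 1\<bar>"
    have "C > 0" "K \<ge> 0"
      using G by (auto simp: C_def K_def)
    have tangent: "C * ln (real t) \<le> real t - 1 + K" if "t \<ge> 1" for t :: nat
      unfolding K_def using \<open>C > 0\<close> that by (intro ln_tangent) auto
    \<comment> \<open>As \<open>ln (d n)\<close> is at most \<open>2 * k n\<close>, this constant
      gives \<open>(K + 1) * \<Delta> n \<le> k n\<close>; adding 1 to \<open>K\<close> keeps the
      denominator positive.\<close>
    have "eventually (\<lambda>n. norm (real (\<Delta> n)) \<le> 1 / (2 * (K + 1)) * norm (ln (real (d n)))) sequentially"
      using \<open>K \<ge> 0\<close> by (intro landau_o.smallD[OF \<Delta>]) simp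
    then show "eventually (\<lambda>n. \<forall>f :: 'a formula. formula_over n f \<and> monotone_formula f \<and>
        formula_poly f = formula_poly (F n) \<and> depth f \<le> \<Delta> n \<longrightarrow>
        real n powr G \<le> real (num_leaves f)) sequentially"
      using eventually_ge_at_top[of 1] d_ge_2
    proof eventually_elim
      case (elim n)
      then have "d n > 0"
        by simp
      note kr = kr[OF elim(2) this]
      have "k n > 0"
        using kr(2) elim(3) by (intro gr0I) auto
      have "real (d n) \<le> real (2 ^ Suc (k n))"
        unfolding of_nat_le_iff using kr(2) by (rule less_imp_le)
      then have "ln (real (d n)) \<le> ln (2 ^ Suc (k n))"
        using \<open>d n > 0\<close> by (intro ln_mono) simp_all
      also have "\<dots> = (real (k n) + 1) * ln 2"
        by (simp only: ln_realpow) (simp add: algebra_simps)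
      also have "\<dots> \<le> (real (k n) + 1) * 1"
        using ln_2_less_1 by (intro mult_left_mono) auto
      also have "\<dots> \<le> 2 * real (k n)"
        using \<open>k n > 0\<close> by simp
      finally have "norm (ln (real (d n))) \<le> 2 * real (k n)"
        using elim(3) by simp
      then have "1 / (2 * (K + 1)) * norm (ln (real (d n))) \<le> 1 / (2 * (K + 1)) * (2 * real (k n))"
        using \<open>K \<ge> 0\<close> by (intro mult_left_mono) auto
      also have "1 / (2 * (K + 1)) * (2 * real (k n)) = real (k n) / (K + 1)"
        using \<open>K \<ge> 0\<close> by (simp add: field_simps)
      finally have "real (\<Delta> n) \<le> real (k n) / (K + 1)"
        using elim(1) by simp
      then have "(K + 1) * real (\<Delta> n) \<le> real (k n)"
        using \<open>K \<ge> 0\<close> by (simp add: field_simps)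
      then have K\<Delta>: "K * real (\<Delta> n) \<le> real (k n)"
        by (simp add: algebra_simps)
      show ?case
      proof (intro allI impI; elim conjE)
        fix f :: "'a formula"
        assume f: "formula_over n f" "monotone_formula f" "formula_poly f = formula_poly (F n)" "depth f \<le> \<Delta> n"
        have "monoms f = tree_monoms (r n) (k n) 1"
          using monotone_formula_keys[OF f(2)] f(3) keys[OF \<open>d n > 0\<close>] by simp
        then have "real (r n) powr (C * ln (2 ^ k n) - K * real (depth f)) \<le> real (num_leaves f)"
          using num_leaves_lower_bound[OF tangent _ \<open>K \<ge> 0\<close> f(1)] \<open>C > 0\<close> kr(3) by simp
        moreover have "real (r n) powr (3 * G * real (k n)) \<le> real (r n) powr (C * ln (2 ^ k n) - K * real (depth f))"
        proof (rule powr_mono)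
          have "C * ln (2 ^ k n) = (3 * G + 1) * real (k n)"
            by (simp add: C_def ln_realpow)
          moreover have "K * real (depth f) \<le> K * real (\<Delta> n)"
            using f(4) \<open>K \<ge> 0\<close> by (intro mult_left_mono) auto
          ultimately show "3 * G * real (k n) \<le> C * ln (2 ^ k n) - K * real (depth f)"
            using K\<Delta> by (simp add: algebra_simps)
        qed (use kr(3) in simp)
        moreover have "real n powr G \<le> (real (r n) powr (3 * real (k n))) powr G"
        proof (rule powr_mono2[OF G])
          have "real n \<le> real ((r n ^ 3) ^ k n)"
            using kr(5) \<open>k n > 0\<close> by (subst of_nat_le_iff)
          also have "\<dots> = real (r n) powr real (3 * k n)"
            using kr(3) by (subst powr_realpow) (auto simp: power_mult)
          finally show "real n \<le> real (r n) powr (3 * real (k n))"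
            by simp
        qed simp
        ultimately show "real n powr G \<le> real (num_leaves f)"
          by (simp add: powr_powr ac_simps)
      qed
    qed
  qed
  show ?thesis
    using F depth lower by (intro exI[of _ F] exI[of _ "\<lambda>n. formula_poly (F n)"]) blast
qed

end
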